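(* Let $R$ be a commutative ring and let $\mathfrak{a}\subseteq R$ be an ideal. If there exists a finite generating family $(a_i)_{i=1}^n$ of $\mathfrak{a}$ such that the sequence $(a_i)_{i=1}^m$ is weakly proregular for every $m\in[1,n-1]$ and that the one-element sequence $a_i$ is weakly proregular for every $i\in[2,n]$, then every $R$-module is weakly $\mathfrak{a}$-fair.
   Context: Rings are commutative with unit (not assumed noetherian). $\mathrm{Var}(\mathfrak{a})$ is the set of prime ideals of $R$ containing $\mathfrak{a}$, and for an $R$-module $M$, $\Gamma_{\mathfrak{a}}(M)=\{x\in M\mid\exists n\in\mathbb{N}:\mathfrak{a}^nx=0\}$. For $x\in M$, $(0:_Rx)=\{r\in R\mid rx=0\}$. The weak assassin $\mathrm{Ass}^{\rm f}_R(M)$ is the set of prime ideals $\mathfrak{p}$ of $R$ such that there exists $x\in M$ for which $\mathfrak{p}$ is minimal (with respect to inclusion) among the prime ideals containing $(0:_Rx)$. An $R$-module $M$ is called weakly $\mathfrak{a}$-fair if $\mathrm{Ass}^{\rm f}_R(M/\Gamma_{\mathfrak{a}}(M))=\mathrm{Ass}^{\rm f}_R(M)\setminus\mathrm{Var}(\mathfrak{a})$. For integers $k,l$, $[k,l]$ denotes the set of integers $i$ with $k\leq i\leq l$. Weak proregularity: let $\mathbf{b}=(b_i)_{i=1}^m$ be a finite family in $R$ generating an ideal $\mathfrak{b}$. Let $(H^i_{\mathfrak{b}})_{i\in\mathbb{Z}}$ denote the right derived cohomological functor of the left exact functor $\Gamma_{\mathfrak{b}}$ (local cohomology with respect to $\mathfrak{b}$),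 and let $(\check{H}^i(\mathbf{b},\bullet))_{i\in\mathbb{Z}}$ denote Čech cohomology with respect to $\mathbf{b}$, i.e., $\check{H}^i(\mathbf{b},M)$ is the $i$-th cohomology of the complex $M\otimes_R\bigotimes_{j=1}^m(R\rightarrow R_{b_j})$, with $R$ in degree $0$ and $R_{b_j}$ in degree $1$. The canonical isomorphism $\Gamma_{\mathfrak{b}}(\bullet)\cong\check{H}^0(\mathbf{b},\bullet)$ extends canonically to a morphism of $\delta$-functors $\gamma_{\mathbf{b}}\colon(H^i_{\mathfrak{b}}(\bullet))_{i\in\mathbb{Z}}\rightarrow(\check{H}^i(\mathbf{b},\bullet))_{i\in\mathbb{Z}}$. The sequence $\mathbf{b}$ is called weakly proregular if $\gamma_{\mathbf{b}}$ is an isomorphism. *)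

theory Defs
  imports "HOL-Algebra.Module" "HOL-Algebra.Ideal_Product"
begin

section \<open>Torsion, weak assassins and fairness\<close>

primrec ideal_power :: "('a, 'r) ring_scheme \<Rightarrow> 'a set \<Rightarrow> nat \<Rightarrow> 'a set" where
  "ideal_power R I 0 = carrier R"
| "ideal_power R I (Suc n) = ideal_prod R (ideal_power R I n) I"

definition torsion :: "('a, 'r) ring_scheme \<Rightarrow> 'a set \<Rightarrow> ('a, 'b, 'm) module_scheme \<Rightarrow> 'b set" where
  "torsion R I M = {x \<in> carrier M. \<exists>n. \<forall>r \<in> ideal_power R I n. r \<odot>\<^bsub>M\<^esub> x = \<zero>\<^bsub>M\<^esub>}"

definition annihilator :: "('a, 'r) ring_scheme \<Rightarrow> ('a, 'b, 'm) module_scheme \<Rightarrow> 'b \<Rightarrow> 'a set" where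
  "annihilator R M x = {r \<in> carrier R. r \<odot>\<^bsub>M\<^esub> x = \<zero>\<^bsub>M\<^esub>}"

definition Var :: "('a, 'r) ring_scheme \<Rightarrow> 'a set \<Rightarrow> 'a set set" where
  "Var R I = {p. primeideal p R \<and> I \<subseteq> p}"

definition weak_assassin :: "('a, 'r) ring_scheme \<Rightarrow> ('a, 'b, 'm) module_scheme \<Rightarrow> 'a set set" where
  "weak_assassin R M = {p. \<exists>x \<in> carrier M. p \<in> Var R (annihilator R M x) \<and>
     (\<forall>q \<in> Var R (annihilator R M x). q \<subseteq> p \<longrightarrow> q = p)}"

text \<open>The ring operations \<^const>\<open>mult\<close> and \<^const>\<open>one\<close> that every module record carries are
  irrelevant for modules; they are left unspecified throughout.\<close>

definition quotient_module :: "('a, 'b, 'm) module_scheme \<Rightarrow> 'b set \<Rightarrow> ('a, 'b set) module" where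
  "quotient_module M N =
     \<lparr>carrier = a_rcosets\<^bsub>M\<^esub> N, mult = undefined, one = undefined,
      zero = N, add = set_add M, smult = (\<lambda>r X. \<Union>x \<in> X. N +>\<^bsub>M\<^esub> (r \<odot>\<^bsub>M\<^esub> x))\<rparr>"

definition weakly_fair :: "('a, 'r) ring_scheme \<Rightarrow> 'a set \<Rightarrow> ('a, 'b, 'm) module_scheme \<Rightarrow> bool" where
  "weakly_fair R I M \<longleftrightarrow>
     weak_assassin R (quotient_module M (torsion R I M)) = weak_assassin R M - Var R I"


section \<open>Homomorphisms, complexes and cohomology\<close>

definition mod_hom ::
    "('a, 'r) ring_scheme \<Rightarrow> ('a, 'b) module \<Rightarrow> ('a, 'c) module \<Rightarrow> ('b \<Rightarrow> 'c) set" where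
  "mod_hom R M N = {f \<in> carrier M \<rightarrow> carrier N.
     (\<forall>x \<in> carrier M. \<forall>y \<in> carrier M. f (x \<oplus>\<^bsub>M\<^esub> y) = f x \<oplus>\<^bsub>N\<^esub> f y) \<and>
     (\<forall>r \<in> carrier R. \<forall>x \<in> carrier M. f (r \<odot>\<^bsub>M\<^esub> x) = r \<odot>\<^bsub>N\<^esub> f x)}"

definition mod_ker :: "('a, 'b) module \<Rightarrow> ('a, 'c) module \<Rightarrow> ('b \<Rightarrow> 'c) \<Rightarrow> 'b set" where
  "mod_ker M N f = {x \<in> carrier M. f x = \<zero>\<^bsub>N\<^esub>}"

definition short_exact :: "('a, 'r) ring_scheme \<Rightarrow> ('a, 'b) module \<Rightarrow> ('a, 'c) module \<Rightarrow>
    ('a, 'd) module \<Rightarrow> ('b \<Rightarrow> 'c) \<Rightarrow> ('c \<Rightarrow> 'd) \<Rightarrow> bool" where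
  "short_exact R A B C f g \<longleftrightarrow> f \<in> mod_hom R A B \<and> g \<in> mod_hom R B C \<and>
     inj_on f (carrier A) \<and> f ` carrier A = mod_ker B C g \<and> g ` carrier B = carrier C"

text \<open>Cochain complexes concentrated in nonnegative degrees.\<close>

record ('a, 'b) cochain =
  cobj :: "nat \<Rightarrow> ('a, 'b) module"
  cdiff :: "nat \<Rightarrow> 'b \<Rightarrow> 'b"

definition chain_map :: "('a, 'r) ring_scheme \<Rightarrow> ('a, 'b) cochain \<Rightarrow> ('a, 'c) cochain \<Rightarrow>
    (nat \<Rightarrow> 'b \<Rightarrow> 'c) \<Rightarrow> bool" where
  "chain_map R K L \<phi> \<longleftrightarrow> (\<forall>n. \<phi> n \<in> mod_hom R (cobj K n) (cobj L n) \<and>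
     (\<forall>x \<in> carrier (cobj K n). \<phi> (Suc n) (cdiff K n x) = cdiff L n (\<phi> n x)))"

definition cocycles :: "('a, 'b) cochain \<Rightarrow> nat \<Rightarrow> 'b set" where
  "cocycles K n = mod_ker (cobj K n) (cobj K (Suc n)) (cdiff K n)"

definition coboundaries :: "('a, 'b) cochain \<Rightarrow> nat \<Rightarrow> 'b set" where
  "coboundaries K n =
     (case n of 0 \<Rightarrow> {\<zero>\<^bsub>cobj K 0\<^esub>} | Suc k \<Rightarrow> cdiff K k ` carrier (cobj K k))"

definition cohomology :: "('a, 'b) cochain \<Rightarrow> nat \<Rightarrow> ('a, 'b set) module" where
  "cohomology K n = quotient_module ((cobj K n)\<lparr>carrier := cocycles K n\<rparr>) (coboundaries K n)"

definition coh_class :: "('a, 'b) cochain \<Rightarrow> nat \<Rightarrow> 'b \<Rightarrow> 'b set" where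
  "coh_class K n z = coboundaries K n +>\<^bsub>cobj K n\<^esub> z"

definition coh_map :: "('a, 'c) cochain \<Rightarrow> (nat \<Rightarrow> 'b \<Rightarrow> 'c) \<Rightarrow> nat \<Rightarrow> 'b set \<Rightarrow> 'c set" where
  "coh_map L \<phi> n X = coh_class L n (\<phi> n (SOME z. z \<in> X))"

text \<open>The connecting map $H^n(C) \to H^{n+1}(A)$ of a short exact sequence of complexes
  $0 \to A \to B \to C \to 0$.\<close>

definition coh_connecting :: "('a, 'b) cochain \<Rightarrow> ('a, 'c) cochain \<Rightarrow> ('a, 'd) cochain \<Rightarrow>
    (nat \<Rightarrow> 'b \<Rightarrow> 'c) \<Rightarrow> (nat \<Rightarrow> 'c \<Rightarrow> 'd) \<Rightarrow> nat \<Rightarrow> 'd set \<Rightarrow> 'b set" where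
  "coh_connecting A B C \<alpha> \<beta> n X = (THE Y. \<exists>y \<in> carrier (cobj B n). \<exists>w \<in> carrier (cobj A (Suc n)).
     \<beta> n y \<in> X \<and> \<alpha> (Suc n) w = cdiff B n y \<and> Y = coh_class A (Suc n) w)"


section \<open>Delta-functors\<close>

text \<open>The data of a covariant \<open>\<delta>\<close>-functor in degrees \<open>\<ge> 0\<close> (the functors considered below vanish in
  negative degrees, where there is nothing to say about a morphism between them).  It is defined on
  the modules with carrier in the type \<open>'v\<close>.\<close>

record ('a, 'v, 'h) delta_functor =
  dobj :: "nat \<Rightarrow> ('a, 'v) module \<Rightarrow> ('a, 'h) module"
  dmap :: "nat \<Rightarrow> ('a, 'v) module \<Rightarrow> ('a, 'v) module \<Rightarrow> ('v \<Rightarrow> 'v) \<Rightarrow> 'h \<Rightarrow> 'h"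
  dconn :: "nat \<Rightarrow> ('a, 'v) module \<Rightarrow> ('a, 'v) module \<Rightarrow> ('a, 'v) module \<Rightarrow>
    ('v \<Rightarrow> 'v) \<Rightarrow> ('v \<Rightarrow> 'v) \<Rightarrow> 'h \<Rightarrow> 'h"

definition delta_morphism :: "('a, 'r) ring_scheme \<Rightarrow> ('a, 'v, 'h) delta_functor \<Rightarrow>
    ('a, 'v, 'k) delta_functor \<Rightarrow> (nat \<Rightarrow> ('a, 'v) module \<Rightarrow> 'h \<Rightarrow> 'k) \<Rightarrow> bool" where
  "delta_morphism R S T \<gamma> \<longleftrightarrow>
     (\<forall>n M. module R M \<longrightarrow> \<gamma> n M \<in> mod_hom R (dobj S n M) (dobj T n M)) \<and>
     (\<forall>n M N f. module R M \<and> module R N \<and> f \<in> mod_hom R M N \<longrightarrow>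
        (\<forall>X \<in> carrier (dobj S n M). \<gamma> n N (dmap S n M N f X) = dmap T n M N f (\<gamma> n M X))) \<and>
     (\<forall>n A B C f g. module R A \<and> module R B \<and> module R C \<and> short_exact R A B C f g \<longrightarrow>
        (\<forall>X \<in> carrier (dobj S n C).
           \<gamma> (Suc n) A (dconn S n A B C f g X) = dconn T n A B C f g (\<gamma> n C X)))"


section \<open>Local cohomology\<close>

text \<open>Injectivity is tested on modules with carrier in the same type \<open>'v\<close>.  This is injectivity in
  the usual sense as soon as \<open>'v\<close> has room for a copy of the ring, by Baer's criterion.\<close>

definition injective_module :: "('a, 'r) ring_scheme \<Rightarrow> ('a, 'v) module \<Rightarrow> bool" where
  "injective_module R I \<longleftrightarrow> module R I \<and>
     (\<forall>(A :: ('a, 'v) module) (B :: ('a, 'v) module) i f.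
        module R A \<and> module R B \<and> i \<in> mod_hom R A B \<and> inj_on i (carrier A) \<and> f \<in> mod_hom R A I \<longrightarrow>
        (\<exists>g \<in> mod_hom R B I. \<forall>x \<in> carrier A. g (i x) = f x))"

definition injective_resolution :: "('a, 'r) ring_scheme \<Rightarrow> ('a, 'v) module \<Rightarrow>
    ('a, 'v) cochain \<Rightarrow> ('v \<Rightarrow> 'v) \<Rightarrow> bool" where
  "injective_resolution R M I \<epsilon> \<longleftrightarrow>
     (\<forall>n. injective_module R (cobj I n) \<and> cdiff I n \<in> mod_hom R (cobj I n) (cobj I (Suc n))) \<and>
     \<epsilon> \<in> mod_hom R M (cobj I 0) \<and> inj_on \<epsilon> (carrier M) \<and> \<epsilon> ` carrier M = cocycles I 0 \<and>
     (\<forall>n. coboundaries I (Suc n) = cocycles I (Suc n))"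

definition chosen_resolution :: "('a, 'r) ring_scheme \<Rightarrow> ('a, 'v) module \<Rightarrow>
    ('a, 'v) cochain \<times> ('v \<Rightarrow> 'v)" where
  "chosen_resolution R M = (SOME (I, \<epsilon>). injective_resolution R M I \<epsilon>)"

abbreviation res :: "('a, 'r) ring_scheme \<Rightarrow> ('a, 'v) module \<Rightarrow> ('a, 'v) cochain" where
  "res R M \<equiv> fst (chosen_resolution R M)"

abbreviation aug :: "('a, 'r) ring_scheme \<Rightarrow> ('a, 'v) module \<Rightarrow> 'v \<Rightarrow> 'v" where
  "aug R M \<equiv> snd (chosen_resolution R M)"

definition chosen_lift :: "('a, 'r) ring_scheme \<Rightarrow> ('a, 'v) module \<Rightarrow> ('a, 'v) module \<Rightarrow>
    ('v \<Rightarrow> 'v) \<Rightarrow> nat \<Rightarrow> 'v \<Rightarrow> 'v" where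
  "chosen_lift R M N f = (SOME \<phi>. chain_map R (res R M) (res R N) \<phi> \<and>
     (\<forall>x \<in> carrier M. \<phi> 0 (aug R M x) = aug R N (f x)))"

text \<open>An injective resolution of the middle term of a short exact sequence that fits, compatibly with
  the augmentations, into a short exact sequence with the chosen resolutions of the outer terms
  (horseshoe lemma).\<close>

definition chosen_horseshoe :: "('a, 'r) ring_scheme \<Rightarrow> ('a, 'v) module \<Rightarrow> ('a, 'v) module \<Rightarrow>
    ('a, 'v) module \<Rightarrow> ('v \<Rightarrow> 'v) \<Rightarrow> ('v \<Rightarrow> 'v) \<Rightarrow>
    ('a, 'v) cochain \<times> ('v \<Rightarrow> 'v) \<times> (nat \<Rightarrow> 'v \<Rightarrow> 'v) \<times> (nat \<Rightarrow> 'v \<Rightarrow> 'v)" where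
  "chosen_horseshoe R A B C f g = (SOME (J, \<eta>, \<alpha>, \<beta>). injective_resolution R B J \<eta> \<and>
     chain_map R (res R A) J \<alpha> \<and> chain_map R J (res R C) \<beta> \<and>
     (\<forall>n. short_exact R (cobj (res R A) n) (cobj J n) (cobj (res R C) n) (\<alpha> n) (\<beta> n)) \<and>
     (\<forall>x \<in> carrier A. \<alpha> 0 (aug R A x) = \<eta> (f x)) \<and>
     (\<forall>x \<in> carrier B. \<beta> 0 (\<eta> x) = aug R C (g x)))"

definition torsion_complex :: "('a, 'r) ring_scheme \<Rightarrow> 'a set \<Rightarrow> ('a, 'v) cochain \<Rightarrow>
    ('a, 'v) cochain" where
  "torsion_complex R I K = K\<lparr>cobj := (\<lambda>n. (cobj K n)\<lparr>carrier := torsion R I (cobj K n)\<rparr>)\<rparr>"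

text \<open>The right derived cohomological functor of the torsion functor.\<close>

definition local_cohomology :: "('a, 'r) ring_scheme \<Rightarrow> 'a set \<Rightarrow> ('a, 'v, 'v set) delta_functor" where
  "local_cohomology R I =
     \<lparr>dobj = (\<lambda>n M. cohomology (torsion_complex R I (res R M)) n),
      dmap = (\<lambda>n M N f. coh_map (torsion_complex R I (res R N)) (chosen_lift R M N f) n),
      dconn = (\<lambda>n A B C f g. case chosen_horseshoe R A B C f g of (J, \<eta>, \<alpha>, \<beta>) \<Rightarrow>
         coh_connecting (torsion_complex R I (res R A)) (torsion_complex R I J)
           (torsion_complex R I (res R C)) \<alpha> \<beta> n)\<rparr>"


section \<open>Tensor products\<close>

definition free_module :: "('a, 'r) ring_scheme \<Rightarrow> 's set \<Rightarrow> ('a, 's \<Rightarrow> 'a) module" where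
  "free_module R S =
     \<lparr>carrier = {u. (\<forall>s \<in> S. u s \<in> carrier R) \<and> (\<forall>s. s \<notin> S \<longrightarrow> u s = \<zero>\<^bsub>R\<^esub>) \<and>
                    finite {s. u s \<noteq> \<zero>\<^bsub>R\<^esub>}},
      mult = undefined, one = undefined, zero = (\<lambda>s. \<zero>\<^bsub>R\<^esub>),
      add = (\<lambda>u v s. u s \<oplus>\<^bsub>R\<^esub> v s), smult = (\<lambda>r u s. r \<otimes>\<^bsub>R\<^esub> u s)\<rparr>"

definition free_basis :: "('a, 'r) ring_scheme \<Rightarrow> 's \<Rightarrow> 's \<Rightarrow> 'a" where
  "free_basis R s = (\<lambda>t. if t = s then \<one>\<^bsub>R\<^esub> else \<zero>\<^bsub>R\<^esub>)"

definition span_module :: "('a, 'r) ring_scheme \<Rightarrow> ('a, 'b) module \<Rightarrow> 'b set \<Rightarrow> 'b set" where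
  "span_module R M X = \<Inter>{N. submodule N R M \<and> X \<subseteq> N}"

text \<open>The tensor product of a family of modules indexed by a finite set \<open>J\<close>: the free module on
  the product of the carriers modulo multilinearity.\<close>

definition tensor_free :: "('a, 'r) ring_scheme \<Rightarrow> 'j set \<Rightarrow> ('j \<Rightarrow> ('a, 'b) module) \<Rightarrow>
    ('a, ('j \<Rightarrow> 'b) \<Rightarrow> 'a) module" where
  "tensor_free R J N = free_module R (\<Pi>\<^sub>E j \<in> J. carrier (N j))"

definition tensor_relations :: "('a, 'r) ring_scheme \<Rightarrow> 'j set \<Rightarrow> ('j \<Rightarrow> ('a, 'b) module) \<Rightarrow>
    (('j \<Rightarrow> 'b) \<Rightarrow> 'a) set" where
  "tensor_relations R J N = span_module R (tensor_free R J N)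
     ({free_basis R (s(j := x \<oplus>\<^bsub>N j\<^esub> y)) \<ominus>\<^bsub>tensor_free R J N\<^esub>
         (free_basis R (s(j := x)) \<oplus>\<^bsub>tensor_free R J N\<^esub> free_basis R (s(j := y))) | s j x y.
         s \<in> (\<Pi>\<^sub>E j \<in> J. carrier (N j)) \<and> j \<in> J \<and> x \<in> carrier (N j) \<and> y \<in> carrier (N j)} \<union>
      {free_basis R (s(j := r \<odot>\<^bsub>N j\<^esub> x)) \<ominus>\<^bsub>tensor_free R J N\<^esub>
         (r \<odot>\<^bsub>tensor_free R J N\<^esub> free_basis R (s(j := x))) | s j r x.
         s \<in> (\<Pi>\<^sub>E j \<in> J. carrier (N j)) \<and> j \<in> J \<and> r \<in> carrier R \<and> x \<in> carrier (N j)})"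

definition tensor :: "('a, 'r) ring_scheme \<Rightarrow> 'j set \<Rightarrow> ('j \<Rightarrow> ('a, 'b) module) \<Rightarrow>
    ('a, (('j \<Rightarrow> 'b) \<Rightarrow> 'a) set) module" where
  "tensor R J N = quotient_module (tensor_free R J N) (tensor_relations R J N)"

definition pure_tensor :: "('a, 'r) ring_scheme \<Rightarrow> 'j set \<Rightarrow> ('j \<Rightarrow> ('a, 'b) module) \<Rightarrow>
    ('j \<Rightarrow> 'b) \<Rightarrow> (('j \<Rightarrow> 'b) \<Rightarrow> 'a) set" where
  "pure_tensor R J N x = tensor_relations R J N +>\<^bsub>tensor_free R J N\<^esub> free_basis R x"

text \<open>Direct sum of a family with finite index set.\<close>

definition direct_sum :: "'e set \<Rightarrow> ('e \<Rightarrow> ('a, 'b) module) \<Rightarrow> ('a, 'e \<Rightarrow> 'b) module" where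
  "direct_sum E N =
     \<lparr>carrier = (\<Pi>\<^sub>E e \<in> E. carrier (N e)), mult = undefined, one = undefined,
      zero = (\<lambda>e \<in> E. \<zero>\<^bsub>N e\<^esub>), add = (\<lambda>x y. \<lambda>e \<in> E. x e \<oplus>\<^bsub>N e\<^esub> y e),
      smult = (\<lambda>r x. \<lambda>e \<in> E. r \<odot>\<^bsub>N e\<^esub> x e)\<rparr>"

definition direct_sum_in :: "'e set \<Rightarrow> ('e \<Rightarrow> ('a, 'b) module) \<Rightarrow> 'e \<Rightarrow> 'b \<Rightarrow> 'e \<Rightarrow> 'b" where
  "direct_sum_in E N e x = (\<lambda>e' \<in> E. if e' = e then x else \<zero>\<^bsub>N e'\<^esub>)"

text \<open>The tensor product of a family of complexes \<open>K j\<close>, for \<open>j\<close> in a finite set \<open>J\<close> of natural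
  numbers.  In degree \<open>n\<close> it is the direct sum, over all multidegrees \<open>e\<close> of total degree \<open>n\<close>, of
  the tensor products of the modules \<open>cobj (K j) (e j)\<close>.  The differential is the unique
  homomorphism with the given values on pure tensors (the usual sign rule, for the factors in
  increasing order of their indices).\<close>

definition multidegrees :: "nat set \<Rightarrow> nat \<Rightarrow> (nat \<Rightarrow> nat) set" where
  "multidegrees J n = {e \<in> J \<rightarrow>\<^sub>E UNIV. (\<Sum>j\<in>J. e j) = n}"

definition tensor_summand :: "('a, 'r) ring_scheme \<Rightarrow> nat set \<Rightarrow> (nat \<Rightarrow> ('a, 'b) cochain) \<Rightarrow>
    (nat \<Rightarrow> nat) \<Rightarrow> ('a, ((nat \<Rightarrow> 'b) \<Rightarrow> 'a) set) module" where
  "tensor_summand R J K e = tensor R J (\<lambda>j. cobj (K j) (e j))"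

definition tensor_obj :: "('a, 'r) ring_scheme \<Rightarrow> nat set \<Rightarrow> (nat \<Rightarrow> ('a, 'b) cochain) \<Rightarrow>
    nat \<Rightarrow> ('a, (nat \<Rightarrow> nat) \<Rightarrow> ((nat \<Rightarrow> 'b) \<Rightarrow> 'a) set) module" where
  "tensor_obj R J K n = direct_sum (multidegrees J n) (tensor_summand R J K)"

definition tensor_elt :: "('a, 'r) ring_scheme \<Rightarrow> nat set \<Rightarrow> (nat \<Rightarrow> ('a, 'b) cochain) \<Rightarrow>
    (nat \<Rightarrow> nat) \<Rightarrow> (nat \<Rightarrow> 'b) \<Rightarrow> (nat \<Rightarrow> nat) \<Rightarrow> ((nat \<Rightarrow> 'b) \<Rightarrow> 'a) set" where
  "tensor_elt R J K e x = direct_sum_in (multidegrees J (\<Sum>j\<in>J. e j)) (tensor_summand R J K) e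
     (pure_tensor R J (\<lambda>j. cobj (K j) (e j)) x)"

definition tensor_diff :: "('a, 'r) ring_scheme \<Rightarrow> nat set \<Rightarrow> (nat \<Rightarrow> ('a, 'b) cochain) \<Rightarrow> nat \<Rightarrow>
    ((nat \<Rightarrow> nat) \<Rightarrow> ((nat \<Rightarrow> 'b) \<Rightarrow> 'a) set) \<Rightarrow> (nat \<Rightarrow> nat) \<Rightarrow> ((nat \<Rightarrow> 'b) \<Rightarrow> 'a) set" where
  "tensor_diff R J K n = (SOME d. d \<in> mod_hom R (tensor_obj R J K n) (tensor_obj R J K (Suc n)) \<and>
     (\<forall>e \<in> multidegrees J n. \<forall>x \<in> (\<Pi>\<^sub>E j \<in> J. carrier (cobj (K j) (e j))).
        d (tensor_elt R J K e x) =
        (\<Oplus>\<^bsub>tensor_obj R J K (Suc n)\<^esub> k \<in> J.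
           ((\<ominus>\<^bsub>R\<^esub> \<one>\<^bsub>R\<^esub>) [^]\<^bsub>R\<^esub> (\<Sum>l \<in> {l \<in> J. l < k}. e l)) \<odot>\<^bsub>tensor_obj R J K (Suc n)\<^esub>
           tensor_elt R J K (e(k := Suc (e k))) (x(k := cdiff (K k) (e k) (x k))))))"

definition tensor_complex :: "('a, 'r) ring_scheme \<Rightarrow> nat set \<Rightarrow> (nat \<Rightarrow> ('a, 'b) cochain) \<Rightarrow>
    ('a, (nat \<Rightarrow> nat) \<Rightarrow> ((nat \<Rightarrow> 'b) \<Rightarrow> 'a) set) cochain" where
  "tensor_complex R J K = \<lparr>cobj = tensor_obj R J K, cdiff = tensor_diff R J K\<rparr>"

definition tensor_chain_map :: "('a, 'r) ring_scheme \<Rightarrow> nat set \<Rightarrow> (nat \<Rightarrow> ('a, 'b) cochain) \<Rightarrow>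
    (nat \<Rightarrow> ('a, 'c) cochain) \<Rightarrow> (nat \<Rightarrow> nat \<Rightarrow> 'b \<Rightarrow> 'c) \<Rightarrow> nat \<Rightarrow>
    ((nat \<Rightarrow> nat) \<Rightarrow> ((nat \<Rightarrow> 'b) \<Rightarrow> 'a) set) \<Rightarrow> (nat \<Rightarrow> nat) \<Rightarrow> ((nat \<Rightarrow> 'c) \<Rightarrow> 'a) set" where
  "tensor_chain_map R J K L \<phi> n = (SOME h. h \<in> mod_hom R (tensor_obj R J K n) (tensor_obj R J L n) \<and>
     (\<forall>e \<in> multidegrees J n. \<forall>x \<in> (\<Pi>\<^sub>E j \<in> J. carrier (cobj (K j) (e j))).
        h (tensor_elt R J K e x) = tensor_elt R J L e (\<lambda>j \<in> J. \<phi> j (e j) (x j))))"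


section \<open>Cech cohomology\<close>

text \<open>The fraction \<open>r / b\<^sup>n\<close> as the equivalence class of \<open>(r, n)\<close>.\<close>

definition fraction :: "('a, 'r) ring_scheme \<Rightarrow> 'a \<Rightarrow> 'a \<Rightarrow> nat \<Rightarrow> ('a \<times> nat) set" where
  "fraction R b r n = {(s, k). s \<in> carrier R \<and> (\<exists>t::nat.
     b [^]\<^bsub>R\<^esub> t \<otimes>\<^bsub>R\<^esub> (b [^]\<^bsub>R\<^esub> k \<otimes>\<^bsub>R\<^esub> r) = b [^]\<^bsub>R\<^esub> t \<otimes>\<^bsub>R\<^esub> (b [^]\<^bsub>R\<^esub> n \<otimes>\<^bsub>R\<^esub> s))}"

text \<open>The factors of the complex defining Cech cohomology have different carrier types, which are
  joined into a single one: elements of the module, of the ring, and of a localisation.\<close>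

datatype ('a, 'v) cech_elt = Mel 'v | Rel 'a | Lel "('a \<times> nat) set"

definition module_copy :: "('a, 'v) module \<Rightarrow> ('a, ('a, 'v) cech_elt) module" where
  "module_copy M =
     \<lparr>carrier = Mel ` carrier M, mult = undefined, one = undefined, zero = Mel \<zero>\<^bsub>M\<^esub>,
      add = (\<lambda>X Y. Mel (the_inv Mel X \<oplus>\<^bsub>M\<^esub> the_inv Mel Y)),
      smult = (\<lambda>r X. Mel (r \<odot>\<^bsub>M\<^esub> the_inv Mel X))\<rparr>"

definition ring_as_module :: "('a, 'r) ring_scheme \<Rightarrow> ('a, ('a, 'v) cech_elt) module" where
  "ring_as_module R =
     \<lparr>carrier = Rel ` carrier R, mult = undefined, one = undefined, zero = Rel \<zero>\<^bsub>R\<^esub>,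
      add = (\<lambda>X Y. Rel (the_inv Rel X \<oplus>\<^bsub>R\<^esub> the_inv Rel Y)),
      smult = (\<lambda>r X. Rel (r \<otimes>\<^bsub>R\<^esub> the_inv Rel X))\<rparr>"

definition localisation :: "('a, 'r) ring_scheme \<Rightarrow> 'a \<Rightarrow> ('a, ('a, 'v) cech_elt) module" where
  "localisation R b =
     \<lparr>carrier = {Lel (fraction R b r n) | r n. r \<in> carrier R}, mult = undefined, one = undefined,
      zero = Lel (fraction R b \<zero>\<^bsub>R\<^esub> 0),
      add = (\<lambda>X Y. Lel (\<Union>(r, n) \<in> the_inv Lel X. \<Union>(s, k) \<in> the_inv Lel Y.
               fraction R b (b [^]\<^bsub>R\<^esub> k \<otimes>\<^bsub>R\<^esub> r \<oplus>\<^bsub>R\<^esub> b [^]\<^bsub>R\<^esub> n \<otimes>\<^bsub>R\<^esub> s) (n + k))),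
      smult = (\<lambda>c X. Lel (\<Union>(r, n) \<in> the_inv Lel X. fraction R b (c \<otimes>\<^bsub>R\<^esub> r) n))\<rparr>"

definition zero_module :: "'b \<Rightarrow> ('a, 'b) module" where
  "zero_module z = \<lparr>carrier = {z}, mult = undefined, one = undefined, zero = z,
     add = (\<lambda>_ _. z), smult = (\<lambda>_ _. z)\<rparr>"

definition module_complex :: "('a, 'v) module \<Rightarrow> ('a, ('a, 'v) cech_elt) cochain" where
  "module_complex M =
     \<lparr>cobj = (\<lambda>n. if n = 0 then module_copy M else zero_module (Mel \<zero>\<^bsub>M\<^esub>)),
      cdiff = (\<lambda>n X. Mel \<zero>\<^bsub>M\<^esub>)\<rparr>"

definition localisation_complex :: "('a, 'r) ring_scheme \<Rightarrow> 'a \<Rightarrow>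
    ('a, ('a, 'v) cech_elt) cochain" where
  "localisation_complex R b =
     \<lparr>cobj = (\<lambda>n. if n = 0 then ring_as_module R else if n = 1 then localisation R b
                 else zero_module (Lel (fraction R b \<zero>\<^bsub>R\<^esub> 0))),
      cdiff = (\<lambda>n X. if n = 0 then Lel (fraction R b (the_inv Rel X) 0)
                 else Lel (fraction R b \<zero>\<^bsub>R\<^esub> 0))\<rparr>"

text \<open>The complex $M \otimes \bigotimes_{j=1}^m (R \to R_{b_j})$; the module is the factor with
  index 0.\<close>

definition cech_factor :: "('a, 'r) ring_scheme \<Rightarrow> (nat \<Rightarrow> 'a) \<Rightarrow> ('a, 'v) module \<Rightarrow> nat \<Rightarrow>
    ('a, ('a, 'v) cech_elt) cochain" where
  "cech_factor R b M j = (if j = 0 then module_complex M else localisation_complex R (b j))"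

type_synonym ('a, 'v) cech_cochain =
  "(nat \<Rightarrow> nat) \<Rightarrow> ((nat \<Rightarrow> ('a, 'v) cech_elt) \<Rightarrow> 'a) set"

definition cech_complex :: "('a, 'r) ring_scheme \<Rightarrow> nat \<Rightarrow> (nat \<Rightarrow> 'a) \<Rightarrow> ('a, 'v) module \<Rightarrow>
    ('a, ('a, 'v) cech_cochain) cochain" where
  "cech_complex R m b M = tensor_complex R {0..m} (cech_factor R b M)"

definition cech_map :: "('a, 'r) ring_scheme \<Rightarrow> nat \<Rightarrow> (nat \<Rightarrow> 'a) \<Rightarrow> ('a, 'v) module \<Rightarrow>
    ('a, 'v) module \<Rightarrow> ('v \<Rightarrow> 'v) \<Rightarrow> nat \<Rightarrow> ('a, 'v) cech_cochain \<Rightarrow> ('a, 'v) cech_cochain" where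
  "cech_map R m b M N f = tensor_chain_map R {0..m} (cech_factor R b M) (cech_factor R b N)
     (\<lambda>j n X. case X of Mel x \<Rightarrow> Mel (f x) | Rel r \<Rightarrow> Rel r | Lel q \<Rightarrow> Lel q)"

definition cech_cohomology :: "('a, 'r) ring_scheme \<Rightarrow> nat \<Rightarrow> (nat \<Rightarrow> 'a) \<Rightarrow>
    ('a, 'v, ('a, 'v) cech_cochain set) delta_functor" where
  "cech_cohomology R m b =
     \<lparr>dobj = (\<lambda>n M. cohomology (cech_complex R m b M) n),
      dmap = (\<lambda>n M N f. coh_map (cech_complex R m b N) (cech_map R m b M N f) n),
      dconn = (\<lambda>n A B C f g. coh_connecting (cech_complex R m b A) (cech_complex R m b B)
         (cech_complex R m b C) (cech_map R m b A B f) (cech_map R m b B C g) n)\<rparr>"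

text \<open>The cochain \<open>x \<otimes> 1 \<otimes> \<dots> \<otimes> 1\<close> of degree 0.\<close>

definition cech_unit :: "('a, 'r) ring_scheme \<Rightarrow> nat \<Rightarrow> (nat \<Rightarrow> 'a) \<Rightarrow> ('a, 'v) module \<Rightarrow> 'v \<Rightarrow>
    ('a, 'v) cech_cochain" where
  "cech_unit R m b M x = tensor_elt R {0..m} (cech_factor R b M) (\<lambda>j \<in> {0..m}. 0)
     (\<lambda>j \<in> {0..m}. if j = 0 then Mel x else Rel \<one>\<^bsub>R\<^esub>)"


section \<open>Weak proregularity\<close>

text \<open>A morphism of \<open>\<delta>\<close>-functors from local cohomology to Cech cohomology that extends the canonical
  isomorphism \<open>\<Gamma>(M) \<cong> H\<^sup>0(b, M)\<close>, \<open>x \<mapsto> x \<otimes> 1 \<otimes> \<dots> \<otimes> 1\<close>, where \<open>\<Gamma>(M)\<close> is identified with local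
  cohomology in degree 0 by the augmentation.  As local cohomology is a universal \<open>\<delta>\<close>-functor, this
  determines the morphism uniquely on carriers.\<close>

definition canonical_comparison :: "('a, 'r) ring_scheme \<Rightarrow> nat \<Rightarrow> (nat \<Rightarrow> 'a) \<Rightarrow>
    (nat \<Rightarrow> ('a, 'v) module \<Rightarrow> 'v set \<Rightarrow> ('a, 'v) cech_cochain set) \<Rightarrow> bool" where
  "canonical_comparison R m b \<gamma> \<longleftrightarrow>
     delta_morphism R (local_cohomology R (Idl\<^bsub>R\<^esub> (b ` {1..m}))) (cech_cohomology R m b) \<gamma> \<and>
     (\<forall>M. module R M \<longrightarrow> (\<forall>x \<in> torsion R (Idl\<^bsub>R\<^esub> (b ` {1..m})) M.
        \<gamma> 0 M (coh_class (torsion_complex R (Idl\<^bsub>R\<^esub> (b ` {1..m})) (res R M)) 0 (aug R M x)) =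
        coh_class (cech_complex R m b M) 0 (cech_unit R m b M x)))"

text \<open>HOL has no type of all modules, so the functors are considered on the modules with carrier in
  a fixed type.  The following type, for arbitrary \<open>'u\<close>, has cardinality
  \<open>\<kappa> = 2 ^ (\<bar>'a\<bar> \<cdot> \<aleph>\<^sub>0 + \<bar>'u\<bar>)\<close>, so that \<open>\<kappa> ^ (\<bar>'a\<bar> \<cdot> \<aleph>\<^sub>0) = \<kappa>\<close>.  Hence every module over a ring
  with carrier in \<open>'a\<close> that has at most \<open>\<kappa>\<close> elements, in particular the ring itself, has an injective
  resolution by modules of this size, and \<open>'u\<close> can be chosen so as to accommodate any given
  module.\<close>

type_synonym ('a, 'u) universe = "('a \<times> nat + 'u) set"

definition weakly_proregular :: "'u itself \<Rightarrow> ('a, 'r) ring_scheme \<Rightarrow> nat \<Rightarrow> (nat \<Rightarrow> 'a) \<Rightarrow> bool" where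
  "weakly_proregular (_ :: 'u itself) R m b \<longleftrightarrow>
     (\<exists>\<gamma> :: nat \<Rightarrow> ('a, ('a, 'u) universe) module \<Rightarrow> ('a, 'u) universe set \<Rightarrow>
            ('a, ('a, 'u) universe) cech_cochain set.
        canonical_comparison R m b \<gamma> \<and>
        (\<forall>n M. module R M \<longrightarrow>
           bij_betw (\<gamma> n M)
             (carrier (dobj (local_cohomology R (Idl\<^bsub>R\<^esub> (b ` {1..m}))) n M))
             (carrier (dobj (cech_cohomology R m b) n M))))"

end

theory Submission
  imports "HOL-Algebra.Ring_Divisibility" Defs
begin

text \<open>The theorem holds because the ideal \<open>\<aa>\<close> is generated by a finite set \<open>S\<close>; then every module
  is weakly \<open>\<aa>\<close>-fair, by the following elementary argument.

  Let \<open>\<Gamma>\<close> be the torsion submodule of \<open>M\<close>, let \<open>x \<in> M\<close>, and compare the ideals \<open>A = (0 : x)\<close> and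
  \<open>J = (\<Gamma> : x)\<close>, the annihilators of \<open>x\<close> in \<open>M\<close> and of its class in \<open>M / \<Gamma>\<close>.  Every element of \<open>J\<close>
  is multiplied into \<open>A\<close> by a power of each \<open>c \<in> S\<close>, so the primes not containing \<open>S\<close> contain \<open>A\<close> if and
  only if they contain \<open>J\<close> (\<open>torsion_colon_subset_prime\<close>).  All primes below such a prime also fail to
  contain \<open>S\<close>, so for primes outside \<open>Var(\<aa>)\<close> being minimal over \<open>A\<close> and being minimal over \<open>J\<close> are the
  same thing.

  It remains to see that a prime \<open>p\<close> minimal over \<open>J\<close> cannot contain \<open>S\<close>
  (\<open>minimal_prime_over_torsion_colon\<close>).  If it did, then, \<open>p\<close> being the only prime of the localisation
  at \<open>p\<close> that contains \<open>J\<close>, each \<open>c \<in> S\<close> would be nilpotent modulo \<open>J\<close> there: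
  \<open>s c\<^sup>k \<in> J\<close> for some \<open>s \<notin> p\<close> (\<open>minimal_prime_cleared_power\<close>).  As \<open>S\<close> is finite,
  one \<open>s\<close> serves all \<open>c\<close>, so that powers of all generators send \<open>s x\<close> into \<open>\<Gamma>\<close>.  Since \<open>M / \<Gamma>\<close>
  is torsion-free (\<open>mem_torsion_if_power_multiples\<close>), \<open>s x \<in> \<Gamma>\<close>, that is, \<open>s \<in> J \<subseteq> p\<close>: a
  contradiction.\<close>

section \<open>Minimal primes\<close>

text \<open>Krull's lemma: an ideal that is maximal among those containing \<open>J\<close> and disjoint from \<open>T\<close> is
  prime, since for \<open>a, b\<close> outside it the two ideals enlarged by \<open>a\<close> and by \<open>b\<close> both meet \<open>T\<close>, and
  the product of the two elements found there is again in \<open>T\<close>.\<close>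

lemma (in cring) prime_avoiding_multiplicative_set:
  assumes J: "ideal J R" and T: "T \<subseteq> carrier R" "\<one> \<in> T"
    and mult: "\<And>s t. s \<in> T \<Longrightarrow> t \<in> T \<Longrightarrow> s \<otimes> t \<in> T"
    and disj: "J \<inter> T = {}"
  obtains q where "primeideal q R" "J \<subseteq> q" "q \<inter> T = {}"
proof -
  define \<A> where "\<A> = {I. ideal I R \<and> J \<subseteq> I \<and> I \<inter> T = {}}"
  have "\<exists>q\<in>\<A>. \<forall>I\<in>\<A>. q \<subseteq> I \<longrightarrow> I = q"
  proof (rule subset_Zorn_nonempty)
    show "\<A> \<noteq> {}" using J disj by (auto simp: \<A>_def)
  next
    fix C assume C: "C \<noteq> {}" "subset.chain \<A> C"
    have CA: "C \<subseteq> \<A>" using C(2) by (simp add: pred_on.chain_def)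
    have "subset.chain {I. ideal I R} C"
      using C(2) by (auto simp: pred_on.chain_def \<A>_def)
    from chain_Union_is_ideal[OF this] C(1) have "ideal (\<Union>C) R" by simp
    moreover have "J \<subseteq> \<Union>C" using C(1) CA by (auto simp: \<A>_def)
    moreover have "\<Union>C \<inter> T = {}" using CA by (auto simp: \<A>_def)
    ultimately show "\<Union>C \<in> \<A>" by (simp add: \<A>_def)
  qed
  then obtain q where qA: "q \<in> \<A>" and qmax: "\<And>I. I \<in> \<A> \<Longrightarrow> q \<subseteq> I \<Longrightarrow> I = q"
    by blast
  then have q: "ideal q R" "J \<subseteq> q" "q \<inter> T = {}" by (simp_all add: \<A>_def)
  interpret q: ideal q R by (rule q(1))
  have meets: "\<exists>i \<in> q. \<exists>r \<in> carrier R. i \<oplus> r \<otimes> a \<in> T" if a: "a \<in> carrier R" "a \<notin> q" for a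
  proof -
    let ?I = "q <+>\<^bsub>R\<^esub> PIdl a"
    have I: "ideal ?I R" by (intro add_ideals q(1) cgenideal_ideal a)
    have zero: "\<zero> \<in> PIdl a" and aI: "a \<in> PIdl a"
      using additive_subgroup.zero_closed[OF ideal.axioms(1)[OF cgenideal_ideal[OF a(1)]]]
        cgenideal_self[OF a(1)] by auto
    have sub: "q \<subseteq> ?I"
    proof
      fix i assume i: "i \<in> q"
      then have "i = i \<oplus> \<zero>" by (simp add: q.Icarr)
      with i zero show "i \<in> ?I" unfolding set_add_def' by blast
    qed
    have "a = \<zero> \<oplus> a" using a by simp
    with aI have "a \<in> ?I" unfolding set_add_def' using q.zero_closed by blast
    with a have "?I \<notin> \<A>" using qmax[OF _ sub] by auto
    with I sub q have "?I \<inter> T \<noteq> {}" by (auto simp: \<A>_def)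
    then show ?thesis unfolding set_add_def' cgenideal_def by blast
  qed
  have "primeideal q R"
  proof (rule primeidealI)
    show "ideal q R" by (rule q(1))
    show "cring R" by (rule is_cring)
    show "carrier R \<noteq> q" using T q(3) by auto
  next
    fix a b assume ab: "a \<in> carrier R" "b \<in> carrier R" "a \<otimes> b \<in> q"
    show "a \<in> q \<or> b \<in> q"
    proof (rule ccontr)
      assume "\<not> (a \<in> q \<or> b \<in> q)"
      with meets ab obtain i r j s where ir: "i \<in> q" "r \<in> carrier R" "i \<oplus> r \<otimes> a \<in> T"
        and js: "j \<in> q" "s \<in> carrier R" "j \<oplus> s \<otimes> b \<in> T" by meson
      have c: "i \<in> carrier R" "j \<in> carrier R" using ir js by (simp_all add: q.Icarr)
      have "(i \<oplus> r \<otimes> a) \<otimes> (j \<oplus> s \<otimes> b)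
          = i \<otimes> (j \<oplus> s \<otimes> b) \<oplus> ((r \<otimes> a) \<otimes> j \<oplus> (r \<otimes> s) \<otimes> (a \<otimes> b))"
        using ab ir(2) js(2) c by algebra
      also have "\<dots> \<in> q"
        using ab ir js c by (simp add: q.I_r_closed q.I_l_closed)
      finally show False using mult[OF ir(3) js(3)] q(3) by blast
    qed
  qed
  with q that show thesis by blast
qed

text \<open>In the localisation at \<open>p\<close>, the radical of \<open>J\<close> is the maximal ideal; the lemma says this without
  forming the localisation.  Otherwise a prime containing \<open>J\<close> avoids the multiplicative set of all
  \<open>s c\<^sup>k\<close> with \<open>s \<notin> p\<close>; it lies inside \<open>p\<close> (take \<open>k = 0\<close>) and misses \<open>c \<in> p\<close> (take \<open>s = 1\<close>),
  against minimality.\<close>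

lemma (in cring) minimal_prime_cleared_power:
  assumes J: "ideal J R" and p: "primeideal p R" "J \<subseteq> p"
    and min: "\<And>q. primeideal q R \<Longrightarrow> J \<subseteq> q \<Longrightarrow> q \<subseteq> p \<Longrightarrow> q = p"
    and c: "c \<in> p"
  shows "\<exists>s \<in> carrier R - p. \<exists>k::nat. s \<otimes> c [^] k \<in> J"
proof (rule ccontr)
  assume neg: "\<not> ?thesis"
  interpret p: primeideal p R by (rule p(1))
  have cR: "c \<in> carrier R" using c by (rule p.Icarr)
  have one: "\<one> \<notin> p" using p.I_notcarr p.one_imp_carrier by auto
  let ?T = "{s \<otimes> c [^] (k::nat) | s k. s \<in> carrier R - p}"
  obtain q where q: "primeideal q R" "J \<subseteq> q" "q \<inter> ?T = {}"
  proof (rule prime_avoiding_multiplicative_set[OF J])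
    show "?T \<subseteq> carrier R" using cR by auto
    have "\<one> = \<one> \<otimes> c [^] (0::nat)" by simp
    then show "\<one> \<in> ?T" using one by blast
    show "J \<inter> ?T = {}" using neg by auto
  next
    fix x y assume "x \<in> ?T" "y \<in> ?T"
    then obtain s k t l where x: "s \<in> carrier R - p" "x = s \<otimes> c [^] (k::nat)"
      and y: "t \<in> carrier R - p" "y = t \<otimes> c [^] (l::nat)" by blast
    have "x \<otimes> y = (s \<otimes> t) \<otimes> (c [^] k \<otimes> c [^] l)"
      using x y cR by (simp add: m_ac)
    then have "x \<otimes> y = (s \<otimes> t) \<otimes> c [^] (k + l)" using cR by (simp add: nat_pow_mult)
    moreover have "s \<otimes> t \<in> carrier R - p" using x y p.I_prime by auto
    ultimately show "x \<otimes> y \<in> ?T" by blast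
  qed
  interpret q: primeideal q R by (rule q(1))
  have avoids: "s \<otimes> c [^] k \<notin> q" if "s \<in> carrier R - p" for s and k :: nat
    using q(3) that by blast
  have "q \<subseteq> p"
  proof
    fix s assume s: "s \<in> q"
    then have "s \<otimes> c [^] (0::nat) \<in> q" by (simp add: q.Icarr)
    with avoids[of s 0] s show "s \<in> p" using q.Icarr by blast
  qed
  with min q have "q = p" by blast
  moreover have "c \<notin> q" using avoids[of \<one> 1] one cR by simp
  ultimately show False using c by simp
qed

lemma (in primeideal) nat_pow_mult_mem_imp_mem:
  assumes "a \<in> carrier R" "a \<notin> I" "r \<in> carrier R" "a [^] (k::nat) \<otimes> r \<in> I"
  shows "r \<in> I"
  using assms(4)
proof (induction k)
  case 0
  then show ?case using assms by simp
next
  case (Suc k)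
  have "a \<otimes> (a [^] k \<otimes> r) \<in> I"
    using Suc.prems assms by (simp add: m_ac)
  then have "a [^] k \<otimes> r \<in> I" using I_prime[of a "a [^] k \<otimes> r"] assms by auto
  then show ?case by (rule Suc.IH)
qed


section \<open>Torsion with respect to a finitely generated ideal\<close>

lemma (in cring) ideal_power_is_ideal:
  "ideal I R \<Longrightarrow> ideal (ideal_power R I n) R"
  by (induction n) (auto simp: oneideal ideal_prod_is_ideal)

lemma (in ring) nat_pow_mem_ideal_power:
  "c \<in> I \<Longrightarrow> c [^] n \<in> ideal_power R I n"
  by (induction n) (auto intro: ideal_prod.prod)

context module
begin

lemma ideal_submodule_colon:
  assumes N: "submodule N R M" and x: "x \<in> carrier M"
  shows "ideal {r \<in> carrier R. r \<odot>\<^bsub>M\<^esub> x \<in> N} R"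
proof (rule idealI)
  note E = submoduleE[OF N]
  have "\<zero>\<^bsub>M\<^esub> \<in> N" using subgroup.one_closed[OF submodule.axioms(1)[OF N]] by simp
  then show "subgroup {r \<in> carrier R. r \<odot>\<^bsub>M\<^esub> x \<in> N} (add_monoid R)"
    using x E by (intro subgroup.intro)
      (auto simp: smult_l_distr smult_l_minus a_inv_def[symmetric])
  fix a r assume a: "a \<in> {r \<in> carrier R. r \<odot>\<^bsub>M\<^esub> x \<in> N}" and r: "r \<in> carrier R"
  then show "r \<otimes> a \<in> {r \<in> carrier R. r \<odot>\<^bsub>M\<^esub> x \<in> N}"
    using x E by (simp add: smult_assoc1)
  with a r show "a \<otimes> r \<in> {r \<in> carrier R. r \<odot>\<^bsub>M\<^esub> x \<in> N}" by (simp add: R.m_comm)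
qed (rule R.ring_axioms)

lemma ideal_annihilator:
  assumes "x \<in> carrier M"
  shows "ideal (annihilator R M x) R"
proof -
  have "submodule {\<zero>\<^bsub>M\<^esub>} R M" by (rule submoduleI) auto
  from ideal_submodule_colon[OF this assms] show ?thesis by (simp add: annihilator_def)
qed

lemma smult_left_commute:
  assumes "a \<in> carrier R" "b \<in> carrier R" "x \<in> carrier M"
  shows "a \<odot>\<^bsub>M\<^esub> (b \<odot>\<^bsub>M\<^esub> x) = b \<odot>\<^bsub>M\<^esub> (a \<odot>\<^bsub>M\<^esub> x)"
  using assms by (simp add: smult_assoc1[symmetric] R.m_comm)

text \<open>If a power of each generator kills \<open>x\<close>, so does a power of the ideal.  Induction on the sum of
  the exponents replaces the usual pigeonhole argument on monomials: passing from \<open>x\<close> to \<open>c x\<close>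
  lowers the exponent of the generator \<open>c\<close> by one, so one power less kills every \<open>c x\<close>.  The
  exponent exceeds the sum by one to cover \<open>S = {}\<close>, where the ideal is zero but its zeroth
  power is the whole ring.\<close>

lemma ideal_power_smult_zero:
  assumes "finite S" "S \<subseteq> carrier R" "x \<in> carrier M"
    and "\<And>c. c \<in> S \<Longrightarrow> c [^] (f c :: nat) \<odot>\<^bsub>M\<^esub> x = \<zero>\<^bsub>M\<^esub>"
    and "r \<in> ideal_power R (Idl S) (Suc (sum f S))"
  shows "r \<odot>\<^bsub>M\<^esub> x = \<zero>\<^bsub>M\<^esub>"
  using assms(3-)
proof (induction "sum f S" arbitrary: f x r rule: less_induct)
  case (less f x r)
  note S = assms(1,2)
  have IdlS: "ideal (Idl S) R" using S by (simp add: genideal_ideal)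
  have kill: "t \<odot>\<^bsub>M\<^esub> (c \<odot>\<^bsub>M\<^esub> x) = \<zero>\<^bsub>M\<^esub>"
    if c: "c \<in> S" and t: "t \<in> ideal_power R (Idl S) (sum f S)" for c t
  proof -
    have cR: "c \<in> carrier R" using c S by auto
    have tR: "t \<in> carrier R"
      using t ideal.Icarr[OF ideal_power_is_ideal[OF IdlS]] by blast
    show ?thesis
    proof (cases "f c")
      case 0
      with less.prems(1) less.prems(2)[OF c] have "x = \<zero>\<^bsub>M\<^esub>" by simp
      with cR tR show ?thesis by simp
    next
      case (Suc m)
      let ?g = "f(c := m)"
      have sum: "sum f S = Suc (sum ?g S)"
        using S c Suc by (simp add: sum.remove[of S c])
      have "d [^] ?g d \<odot>\<^bsub>M\<^esub> (c \<odot>\<^bsub>M\<^esub> x) = \<zero>\<^bsub>M\<^esub>" if d: "d \<in> S" for d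
      proof (cases "d = c")
        case True
        then show ?thesis
          using less.prems(2)[OF c] Suc cR less.prems(1) by (simp add: smult_assoc1)
      next
        case False
        have dR: "d \<in> carrier R" using d S by auto
        have "d [^] f d \<odot>\<^bsub>M\<^esub> (c \<odot>\<^bsub>M\<^esub> x) = c \<odot>\<^bsub>M\<^esub> (d [^] f d \<odot>\<^bsub>M\<^esub> x)"
          using cR dR less.prems(1) by (simp add: smult_left_commute)
        with False show ?thesis using less.prems(2)[OF d] cR by simp
      qed
      with less.hyps[of ?g "c \<odot>\<^bsub>M\<^esub> x" t] show ?thesis
        using sum t cR less.prems(1) by simp
    qed
  qed
  have kill_prod: "(t \<otimes> u) \<odot>\<^bsub>M\<^esub> x = \<zero>\<^bsub>M\<^esub>"
    if t: "t \<in> ideal_power R (Idl S) (sum f S)" and u: "u \<in> Idl S" for t u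
  proof -
    have tR: "t \<in> carrier R"
      using t ideal.Icarr[OF ideal_power_is_ideal[OF IdlS]] by blast
    have tx: "t \<odot>\<^bsub>M\<^esub> x \<in> carrier M" using tR less.prems(1) by simp
    have "c \<odot>\<^bsub>M\<^esub> (t \<odot>\<^bsub>M\<^esub> x) = \<zero>\<^bsub>M\<^esub>" if "c \<in> S" for c
      using kill[OF that t] smult_left_commute[of c t x] that S tR less.prems(1) by auto
    then have "S \<subseteq> annihilator R M (t \<odot>\<^bsub>M\<^esub> x)" using S by (auto simp: annihilator_def)
    then have "Idl S \<subseteq> annihilator R M (t \<odot>\<^bsub>M\<^esub> x)"
      by (rule genideal_minimal[OF ideal_annihilator[OF tx]])
    with u have "u \<in> carrier R" "u \<odot>\<^bsub>M\<^esub> (t \<odot>\<^bsub>M\<^esub> x) = \<zero>\<^bsub>M\<^esub>" by (auto simp: annihilator_def)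
    then show ?thesis using tR less.prems(1) by (simp add: smult_assoc1 smult_left_commute[of t u])
  qed
  have "ideal_power R (Idl S) (Suc (sum f S)) \<subseteq> annihilator R M x"
  proof
    fix r assume "r \<in> ideal_power R (Idl S) (Suc (sum f S))"
    then have "r \<in> ideal_prod R (ideal_power R (Idl S) (sum f S)) (Idl S)" by simp
    then show "r \<in> annihilator R M x"
    proof (induction rule: ideal_prod.induct)
      case (prod t u)
      then have "t \<in> carrier R" "u \<in> carrier R"
        using ideal.Icarr[OF ideal_power_is_ideal[OF IdlS]] ideal.Icarr[OF IdlS] by auto
      with kill_prod[OF prod] show ?case
        by (simp add: annihilator_def)
    next
      case (sum s t)
      then show ?case
        using additive_subgroup.a_closed[OF ideal.axioms(1)[OF ideal_annihilator[OF less.prems(1)]]]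
        by blast
    qed
  qed
  with less.prems(3) show ?case by (auto simp: annihilator_def)
qed

text \<open>This description replaces the powers of the ideal by powers of single elements in everything
  that follows.  It depends on \<open>S\<close> being finite.\<close>

lemma torsion_finitely_generated_iff:
  assumes "finite S" "S \<subseteq> carrier R"
  shows "x \<in> torsion R (Idl S) M \<longleftrightarrow>
    x \<in> carrier M \<and> (\<forall>c \<in> S. \<exists>k::nat. c [^] k \<odot>\<^bsub>M\<^esub> x = \<zero>\<^bsub>M\<^esub>)"
proof
  assume "x \<in> torsion R (Idl S) M"
  then obtain n where x: "x \<in> carrier M"
    and n: "\<And>r. r \<in> ideal_power R (Idl S) n \<Longrightarrow> r \<odot>\<^bsub>M\<^esub> x = \<zero>\<^bsub>M\<^esub>"
    by (auto simp: torsion_def)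
  have "c [^] n \<odot>\<^bsub>M\<^esub> x = \<zero>\<^bsub>M\<^esub>" if "c \<in> S" for c
    using n nat_pow_mem_ideal_power genideal_self[OF assms(2)] that by blast
  with x show "x \<in> carrier M \<and> (\<forall>c \<in> S. \<exists>k::nat. c [^] k \<odot>\<^bsub>M\<^esub> x = \<zero>\<^bsub>M\<^esub>)" by blast
next
  assume R: "x \<in> carrier M \<and> (\<forall>c \<in> S. \<exists>k::nat. c [^] k \<odot>\<^bsub>M\<^esub> x = \<zero>\<^bsub>M\<^esub>)"
  then obtain f :: "'a \<Rightarrow> nat" where "\<And>c. c \<in> S \<Longrightarrow> c [^] f c \<odot>\<^bsub>M\<^esub> x = \<zero>\<^bsub>M\<^esub>" by metis
  with R show "x \<in> torsion R (Idl S) M"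
    unfolding torsion_def using ideal_power_smult_zero[OF assms] by blast
qed

lemma nat_pow_smult_zero_mono:
  assumes "c \<in> carrier R" "x \<in> carrier M" "c [^] (k::nat) \<odot>\<^bsub>M\<^esub> x = \<zero>\<^bsub>M\<^esub>" "k \<le> l"
  shows "c [^] l \<odot>\<^bsub>M\<^esub> x = \<zero>\<^bsub>M\<^esub>"
proof -
  have "c [^] l = c [^] (l - k) \<otimes> c [^] k" using assms by (simp add: R.nat_pow_mult)
  with assms show ?thesis by (simp add: smult_assoc1)
qed

lemma submodule_torsion:
  assumes S: "finite S" "S \<subseteq> carrier R"
  shows "submodule (torsion R (Idl S) M) R M"
proof (rule submoduleI)
  have smult: "r \<odot>\<^bsub>M\<^esub> x \<in> torsion R (Idl S) M"
    if "r \<in> carrier R" "x \<in> torsion R (Idl S) M" for r x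
  proof -
    have "\<exists>k::nat. c [^] k \<odot>\<^bsub>M\<^esub> (r \<odot>\<^bsub>M\<^esub> x) = \<zero>\<^bsub>M\<^esub>" if c: "c \<in> S" for c
    proof -
      obtain k :: nat where "x \<in> carrier M" "c [^] k \<odot>\<^bsub>M\<^esub> x = \<zero>\<^bsub>M\<^esub>"
        using \<open>x \<in> torsion R (Idl S) M\<close> c S by (auto simp: torsion_finitely_generated_iff)
      moreover have "c \<in> carrier R" using c S by auto
      ultimately have "c [^] k \<odot>\<^bsub>M\<^esub> (r \<odot>\<^bsub>M\<^esub> x) = \<zero>\<^bsub>M\<^esub>"
        using that(1) \<open>r \<in> carrier R\<close> by (simp add: smult_left_commute[of _ r])
      then show ?thesis ..
    qed
    with that S show ?thesis by (simp add: torsion_finitely_generated_iff)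
  qed
  then show "\<And>r x. r \<in> carrier R \<Longrightarrow> x \<in> torsion R (Idl S) M \<Longrightarrow> r \<odot>\<^bsub>M\<^esub> x \<in> torsion R (Idl S) M" .
  show "torsion R (Idl S) M \<subseteq> carrier M" by (auto simp: torsion_def)
  show "\<zero>\<^bsub>M\<^esub> \<in> torsion R (Idl S) M"
    using S by (auto simp: torsion_finitely_generated_iff)
  fix x assume x: "x \<in> torsion R (Idl S) M"
  then have xM: "x \<in> carrier M" by (auto simp: torsion_def)
  have "\<ominus>\<^bsub>M\<^esub> x = (\<ominus> \<one>) \<odot>\<^bsub>M\<^esub> x" using xM by (simp add: smult_l_minus)
  with smult[OF _ x] show "\<ominus>\<^bsub>M\<^esub> x \<in> torsion R (Idl S) M" by simp
  fix y assume y: "y \<in> torsion R (Idl S) M"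
  then have yM: "y \<in> carrier M" by (auto simp: torsion_def)
  have "\<exists>k::nat. c [^] k \<odot>\<^bsub>M\<^esub> (x \<oplus>\<^bsub>M\<^esub> y) = \<zero>\<^bsub>M\<^esub>" if c: "c \<in> S" for c
  proof -
    have cR: "c \<in> carrier R" using c S by auto
    obtain k l :: nat where "c [^] k \<odot>\<^bsub>M\<^esub> x = \<zero>\<^bsub>M\<^esub>" "c [^] l \<odot>\<^bsub>M\<^esub> y = \<zero>\<^bsub>M\<^esub>"
      using x y c unfolding torsion_finitely_generated_iff[OF S] by blast
    then have "c [^] (max k l) \<odot>\<^bsub>M\<^esub> x = \<zero>\<^bsub>M\<^esub>" "c [^] (max k l) \<odot>\<^bsub>M\<^esub> y = \<zero>\<^bsub>M\<^esub>"
      using nat_pow_smult_zero_mono cR xM yM by auto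
    then have "c [^] (max k l) \<odot>\<^bsub>M\<^esub> (x \<oplus>\<^bsub>M\<^esub> y) = \<zero>\<^bsub>M\<^esub>"
      using cR xM yM by (simp add: smult_r_distr)
    then show ?thesis ..
  qed
  then show "x \<oplus>\<^bsub>M\<^esub> y \<in> torsion R (Idl S) M"
    using xM yM S by (simp add: torsion_finitely_generated_iff)
qed

text \<open>In other words, \<open>M / \<Gamma>\<close> has no torsion.  The exponents coming from \<open>\<Gamma>\<close> depend on the generator,
  which does no harm because there are finitely many.\<close>

lemma mem_torsion_if_power_multiples:
  assumes S: "finite S" "S \<subseteq> carrier R" and x: "x \<in> carrier M"
    and powers: "\<And>c. c \<in> S \<Longrightarrow> \<exists>k::nat. c [^] k \<odot>\<^bsub>M\<^esub> x \<in> torsion R (Idl S) M"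
  shows "x \<in> torsion R (Idl S) M"
proof -
  have "\<exists>k::nat. c [^] k \<odot>\<^bsub>M\<^esub> x = \<zero>\<^bsub>M\<^esub>" if c: "c \<in> S" for c
  proof -
    obtain k l :: nat where "c [^] l \<odot>\<^bsub>M\<^esub> (c [^] k \<odot>\<^bsub>M\<^esub> x) = \<zero>\<^bsub>M\<^esub>"
      using powers[OF c] c S by (auto simp: torsion_finitely_generated_iff)
    then have "c [^] (l + k) \<odot>\<^bsub>M\<^esub> x = \<zero>\<^bsub>M\<^esub>"
      using c S x by (simp add: R.nat_pow_mult[symmetric] smult_assoc1 subsetD)
    then show ?thesis ..
  qed
  with x S show ?thesis by (simp add: torsion_finitely_generated_iff)
qed


section \<open>Weak assassins\<close>

lemma annihilator_quotient:
  assumes N: "submodule N R M" and x: "x \<in> carrier M"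
  shows "annihilator R (quotient_module M N) (N +>\<^bsub>M\<^esub> x) = {r \<in> carrier R. r \<odot>\<^bsub>M\<^esub> x \<in> N}"
proof -
  interpret N: abelian_subgroup N M
    using submodule.axioms(1)[OF N] M.a_comm_group by (rule abelian_subgroupI2[rotated])
  have "r \<odot>\<^bsub>quotient_module M N\<^esub> (N +>\<^bsub>M\<^esub> x) = N +>\<^bsub>M\<^esub> (r \<odot>\<^bsub>M\<^esub> x)" if r: "r \<in> carrier R" for r
  proof -
    have "N +>\<^bsub>M\<^esub> (r \<odot>\<^bsub>M\<^esub> y) = N +>\<^bsub>M\<^esub> (r \<odot>\<^bsub>M\<^esub> x)" if y: "y \<in> N +>\<^bsub>M\<^esub> x" for y
    proof -
      have yM: "y \<in> carrier M" using x y by (rule N.a_elemrcos_carrier)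
      have "y \<oplus>\<^bsub>M\<^esub> \<ominus>\<^bsub>M\<^esub> x \<in> N" using x y by (rule N.a_rcos_module_imp)
      then have "r \<odot>\<^bsub>M\<^esub> (y \<oplus>\<^bsub>M\<^esub> \<ominus>\<^bsub>M\<^esub> x) \<in> N" using r submoduleE(4)[OF N] by blast
      then have "r \<odot>\<^bsub>M\<^esub> y \<oplus>\<^bsub>M\<^esub> \<ominus>\<^bsub>M\<^esub> (r \<odot>\<^bsub>M\<^esub> x) \<in> N"
        using r x yM by (simp add: smult_r_distr smult_r_minus)
      then have "r \<odot>\<^bsub>M\<^esub> y \<in> N +>\<^bsub>M\<^esub> (r \<odot>\<^bsub>M\<^esub> x)"
        using r x yM by (simp add: N.a_rcos_module)
      then show ?thesis using N.a_repr_independence' r x by simp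
    qed
    moreover have "x \<in> N +>\<^bsub>M\<^esub> x" using x by (rule N.a_rcos_self)
    ultimately have "(\<Union>y \<in> N +>\<^bsub>M\<^esub> x. N +>\<^bsub>M\<^esub> (r \<odot>\<^bsub>M\<^esub> y)) = N +>\<^bsub>M\<^esub> (r \<odot>\<^bsub>M\<^esub> x)" by blast
    then show ?thesis by (simp add: quotient_module_def)
  qed
  moreover have "N +>\<^bsub>M\<^esub> y = N \<longleftrightarrow> y \<in> N" if "y \<in> carrier M" for y
    using that N.a_rcos_const N.a_rcos_self by metis
  moreover have "\<zero>\<^bsub>quotient_module M N\<^esub> = N" by (simp add: quotient_module_def)
  ultimately show ?thesis using x by (simp add: annihilator_def cong: conj_cong)
qed

text \<open>A generator outside \<open>q\<close> can be cancelled modulo \<open>q\<close>, so torsion is invisible to \<open>q\<close>.\<close>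

lemma torsion_colon_subset_prime:
  assumes S: "finite S" "S \<subseteq> carrier R" and x: "x \<in> carrier M"
    and q: "primeideal q R" "annihilator R M x \<subseteq> q" "\<not> S \<subseteq> q"
  shows "{r \<in> carrier R. r \<odot>\<^bsub>M\<^esub> x \<in> torsion R (Idl S) M} \<subseteq> q"
proof safe
  fix r assume r: "r \<in> carrier R" "r \<odot>\<^bsub>M\<^esub> x \<in> torsion R (Idl S) M"
  obtain c where c: "c \<in> S" "c \<notin> q" using q(3) by blast
  have cR: "c \<in> carrier R" using c S by auto
  obtain k :: nat where "c [^] k \<odot>\<^bsub>M\<^esub> (r \<odot>\<^bsub>M\<^esub> x) = \<zero>\<^bsub>M\<^esub>"
    using r(2) c(1) S by (auto simp: torsion_finitely_generated_iff)
  then have "c [^] k \<otimes> r \<in> annihilator R M x"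
    using r(1) cR x by (simp add: annihilator_def smult_assoc1)
  with q show "r \<in> q" using primeideal.nat_pow_mult_mem_imp_mem[OF q(1) cR c(2) r(1)] by blast
qed

text \<open>This is where finite generation matters most: the elements that clear the single generators
  are multiplied together to give one \<open>s \<notin> p\<close> that works for all of \<open>S\<close>.\<close>

lemma minimal_prime_over_torsion_colon:
  assumes S: "finite S" "S \<subseteq> carrier R" and x: "x \<in> carrier M"
  defines "J \<equiv> {r \<in> carrier R. r \<odot>\<^bsub>M\<^esub> x \<in> torsion R (Idl S) M}"
  assumes p: "primeideal p R" "J \<subseteq> p"
    and min: "\<And>q. primeideal q R \<Longrightarrow> J \<subseteq> q \<Longrightarrow> q \<subseteq> p \<Longrightarrow> q = p"
  shows "\<not> S \<subseteq> p"
proof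
  assume Sp: "S \<subseteq> p"
  interpret p: primeideal p R by (rule p(1))
  have J: "ideal J R"
    unfolding J_def using submodule_torsion[OF S] x by (rule ideal_submodule_colon)
  have "\<exists>s \<in> carrier R - p. \<forall>c \<in> F. \<exists>k::nat. s \<otimes> c [^] k \<in> J" if "F \<subseteq> S" for F
    using finite_subset[OF that S(1)] that
  proof (induction F rule: finite_induct)
    case empty
    show ?case using p.I_notcarr p.Icarr by blast
  next
    case (insert c F)
    then obtain s where s: "s \<in> carrier R - p" "\<forall>d \<in> F. \<exists>k::nat. s \<otimes> d [^] k \<in> J" by auto
    from insert.prems Sp have "c \<in> p" by auto
    from minimal_prime_cleared_power[OF J p min this]
    obtain t and k :: nat where t: "t \<in> carrier R - p" "t \<otimes> c [^] k \<in> J" by blast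
    have "s \<otimes> t \<in> carrier R - p" using s t p.I_prime by auto
    moreover have "(s \<otimes> t) \<otimes> c [^] k \<in> J"
      using ideal.I_l_closed[OF J t(2), of s] s t \<open>c \<in> p\<close> by (simp add: R.m_assoc p.Icarr)
    moreover have "\<exists>k::nat. (s \<otimes> t) \<otimes> d [^] k \<in> J" if d: "d \<in> F" for d
    proof -
      obtain l :: nat where l: "s \<otimes> d [^] l \<in> J" using s d by blast
      have "d \<in> carrier R" using d insert.prems S by auto
      then have "(s \<otimes> t) \<otimes> d [^] l = t \<otimes> (s \<otimes> d [^] l)" using s t by (simp add: R.m_ac)
      with ideal.I_l_closed[OF J l, of t] t have "(s \<otimes> t) \<otimes> d [^] l \<in> J" by simp
      then show ?thesis ..
    qed
    ultimately show ?case by blast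
  qed
  then obtain s where s: "s \<in> carrier R - p" "\<forall>c \<in> S. \<exists>k::nat. s \<otimes> c [^] k \<in> J" by blast
  have "s \<odot>\<^bsub>M\<^esub> x \<in> torsion R (Idl S) M"
  proof (rule mem_torsion_if_power_multiples[OF S])
    show "s \<odot>\<^bsub>M\<^esub> x \<in> carrier M" using s x by simp
    fix c assume c: "c \<in> S"
    then obtain k :: nat where k: "s \<otimes> c [^] k \<in> J" using s by blast
    have "c \<in> carrier R" using c S by auto
    then have "c [^] k \<odot>\<^bsub>M\<^esub> (s \<odot>\<^bsub>M\<^esub> x) = (s \<otimes> c [^] k) \<odot>\<^bsub>M\<^esub> x"
      using s x by (simp add: smult_assoc1 smult_left_commute[of s])
    with k have "c [^] k \<odot>\<^bsub>M\<^esub> (s \<odot>\<^bsub>M\<^esub> x) \<in> torsion R (Idl S) M" by (simp add: J_def)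
    then show "\<exists>k::nat. c [^] k \<odot>\<^bsub>M\<^esub> (s \<odot>\<^bsub>M\<^esub> x) \<in> torsion R (Idl S) M" ..
  qed
  with s p(2) show False by (auto simp: J_def)
qed

lemma weakly_fair_finitely_generated:
  assumes S: "finite S" "S \<subseteq> carrier R"
  shows "weakly_fair R (Idl S) M"
proof -
  let ?\<Gamma> = "torsion R (Idl S) M"
  let ?J = "\<lambda>x. {r \<in> carrier R. r \<odot>\<^bsub>M\<^esub> x \<in> ?\<Gamma>}"
  let ?A = "\<lambda>x. annihilator R M x"
  have AJ: "?A x \<subseteq> ?J x" for x
    using subgroup.one_closed[OF submodule.axioms(1)[OF submodule_torsion[OF S]]]
    by (auto simp: annihilator_def)
  have Var: "p \<in> Var R (Idl S) \<longleftrightarrow> S \<subseteq> p" if "primeideal p R" for p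
    using that Idl_subset_ideal[OF primeideal.axioms(1)[OF that] S(2)] by (simp add: Var_def)
  \<comment> \<open>The equality of the two assassins already holds element by element, for a fixed \<open>x\<close>.\<close>
  have equiv: "(p \<in> Var R (?J x) \<and> (\<forall>q \<in> Var R (?J x). q \<subseteq> p \<longrightarrow> q = p)) \<longleftrightarrow>
      (p \<in> Var R (?A x) \<and> (\<forall>q \<in> Var R (?A x). q \<subseteq> p \<longrightarrow> q = p)) \<and> p \<notin> Var R (Idl S)"
    (is "?L \<longleftrightarrow> ?R") if x: "x \<in> carrier M" for x p
  proof
    assume L: ?L
    then have p: "primeideal p R" "?J x \<subseteq> p"
      and min: "\<And>q. primeideal q R \<Longrightarrow> ?J x \<subseteq> q \<Longrightarrow> q \<subseteq> p \<Longrightarrow> q = p"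
      by (auto simp: Var_def)
    have notS: "\<not> S \<subseteq> p" using minimal_prime_over_torsion_colon[OF S x p min] .
    have "q = p" if q: "primeideal q R" "?A x \<subseteq> q" "q \<subseteq> p" for q
      using min[OF q(1) torsion_colon_subset_prime[OF S x q(1,2)] q(3)] notS q(3) by blast
    with notS p AJ[of x] Var[OF p(1)] show ?R by (auto simp: Var_def)
  next
    assume R: ?R
    then have p: "primeideal p R" "?A x \<subseteq> p" by (auto simp: Var_def)
    have "?J x \<subseteq> p" using torsion_colon_subset_prime[OF S x p] R Var[OF p(1)] by blast
    moreover have "q = p" if "q \<in> Var R (?J x)" "q \<subseteq> p" for q
    proof -
      have "q \<in> Var R (?A x)" using that(1) AJ[of x] unfolding Var_def by blast
      with R that(2) show ?thesis by blast
    qed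
    ultimately show ?L using p by (simp add: Var_def)
  qed
  have carrier: "carrier (quotient_module M ?\<Gamma>) = (\<lambda>x. ?\<Gamma> +>\<^bsub>M\<^esub> x) ` carrier M"
    by (auto simp: quotient_module_def A_RCOSETS_def')
  have "weak_assassin R (quotient_module M ?\<Gamma>) =
      {p. \<exists>x \<in> carrier M. p \<in> Var R (?J x) \<and> (\<forall>q \<in> Var R (?J x). q \<subseteq> p \<longrightarrow> q = p)}"
    unfolding weak_assassin_def carrier
    by (simp add: annihilator_quotient[OF submodule_torsion[OF S]] cong: bex_cong)
  also have "\<dots> = {p. \<exists>x \<in> carrier M. (p \<in> Var R (?A x) \<and>
      (\<forall>q \<in> Var R (?A x). q \<subseteq> p \<longrightarrow> q = p)) \<and> p \<notin> Var R (Idl S)}"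
    by (intro Collect_cong bex_cong refl equiv)
  also have "\<dots> = weak_assassin R M - Var R (Idl S)"
    unfolding weak_assassin_def by blast
  finally show ?thesis by (simp add: weakly_fair_def)
qed

end

theorem mainTheorem10:
  fixes R :: "('a, 'r) ring_scheme" and \<aa> :: "'a set"
  assumes "cring R"
    and "ideal \<aa> R"
    and "\<exists>(n::nat) (a :: nat \<Rightarrow> 'a). a \<in> {1..n} \<rightarrow> carrier R \<and> \<aa> = Idl\<^bsub>R\<^esub> (a ` {1..n}) \<and>
           (\<forall>m \<in> {1..n - 1}. weakly_proregular TYPE('u) R m a) \<and>
           (\<forall>i \<in> {2..n}. weakly_proregular TYPE('u) R 1 (\<lambda>_. a i))"
  shows "\<forall>M :: ('a, 'b, 'm) module_scheme. module R M \<longrightarrow> weakly_fair R \<aa> M"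
proof (intro allI impI)
  fix M :: "('a, 'b, 'm) module_scheme" assume "module R M"
  then interpret module R M .
  obtain n :: nat and a where a: "a \<in> {1..n} \<rightarrow> carrier R" "\<aa> = Idl\<^bsub>R\<^esub> (a ` {1..n})"
    using assms(3) by blast
  have "finite (a ` {1..n})" "a ` {1..n} \<subseteq> carrier R" using a(1) by auto
  then show "weakly_fair R \<aa> M" unfolding a(2) by (rule weakly_fair_finitely_generated)
qed

end
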